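(* Let $m=(m(p))_{p\ge 0}$ be a kernel moment sequence (as defined in the context), let $n\ge 1$ be an integer and let $A\in\mathbb{C}^{n\times n}$ be a non-diagonalizable matrix. Then the general solution of the linear system of moment differential equations $\partial_m y(z)=Ay(z)$ is given by $$y(z)=E(Az)v^c,$$ where $v^c$ is an $n$-dimensional constant column vector. That is, the set of solutions $y\in(\mathcal{O}(\mathbb{C}))^n$ of $\partial_m y=Ay$ is exactly $\{E(Az)v^c: v^c\in\mathbb{C}^n\}$.
   Context: Notation. $\mathcal{O}(U)$ is the set of holomorphic functions on $U$. $D(z_0,r)$ is the open disc of center $z_0$ and radius $r$. For $d\in\mathbb{R}$ and $\theta>0$, $S_d(\theta)$ is the sector of nonzero $z$ with $|\arg(z)-d|<\theta/2$ (regarded in the Riemann surface of the logarithm if $\theta>2\pi$). Strongly regular sequences. A sequence of positive reals $\mathbb{M}=(M_p)_{p\ge0}$ with $M_0=1$ is strongly regular if: (lc) $M_p^2\le M_{p-1}M_{p+1}$ for all $p\ge1$; (mg) there is $A>0$ with $M_{p+q}\le A^{p+q}M_pM_q$ for all $p,q\ge0$; (snq) there is $A>0$ with $\sum_{q\ge p}\frac{M_q}{(q+1)M_{q+1}}\le A\frac{M_p}{M_{p+1}}$ for all $p\ge0$. Put $M(0)=0$, $M(t)=\sup_{p\ge0}\log(t^p/M_p)$ for $t>0$, and $\rho(M)=\limsup_{r\to\infty}\frac{\log M(r)}{\log r}$. Proximate orders. A nonzero proximate order is a continuous, piecewise continuously differentiable function $\varrho:(c,\infty)\to[0,\infty)$,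 for some $c\ge0$, with $\lim_{t\to\infty}\varrho(t)\in(0,\infty)$ and $\lim_{t\to\infty}t\varrho'(t)\log t=0$. $\mathbb{M}$ admits a nonzero proximate order if there are a nonzero proximate order $\varrho$ and real constants $a,b$ with $a\le\log(t)\left(\varrho(t)-\frac{\log M(t)}{\log t}\right)\le b$ for all large $t$. Kernels. A pair of kernel functions for $\mathbb{M}$-summability is a pair $(e,E)$ such that: (1) $e\in\mathcal{O}(S_0(\pi/\rho(M)))$; there is $t_0>0$ such that for all $z_0\in S_0(\pi/\rho(M))$ there is $r_0>0$ with $D(z_0,r_0)\subseteq S_0(\pi/\rho(M))$ and $\int_0^{t_0}\sup_{z\in D(z_0,r_0)}|e(t/z)|\frac{dt}{t}<\infty$; and for every $\delta>0$ there are $K_1,K_2>0$ with $|e(z)|\le K_1\exp(-M(|z|/K_2))$ for $z\in S_0(\pi/\rho(M)-\delta)$; (2) $e(x)>0$ for all real $x>0$; (3) $E\in\mathcal{O}(\mathbb{C})$, $|E(z)|\le K_3\exp(M(|z|/K_4))$ for all $z\in\mathbb{C}$ and some $K_3,K_4>0$, and there is $\beta>0$ such that for all $0<\theta<2\pi-\pi/\rho(M)$ and $R>0$ there is $K_5>0$ with $|E(z)|\le K_5/|z|^\beta$ for $z\in S_\pi(\theta)\cap(\mathbb{C}\setminus D(0,R))$; (4) $E(z)=\sum_{p\ge0}\frac{z^p}{m(p)}$ for $z\in\mathbb{C}$, where $m(p)=\int_0^\infty t^{p-1}e(t)\,dt$ for $p\ge0$. Kernel moment sequence. $m=(m(p))_{p\ge0}$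 is called here a kernel moment sequence if it is the sequence of moments $m(p)=\int_0^\infty t^{p-1}e(t)\,dt$ of a pair of kernel functions $(e,E)$ for $\mathbb{M}$-summability, where $\mathbb{M}$ is a strongly regular sequence admitting a nonzero proximate order with $\lim_{p\to\infty}M_p^{1/p}=+\infty$, and moreover $m(0)=1$ and $\liminf_{p\to\infty}m(p)^{1/p}=+\infty$. Moment derivative. $\partial_m\left(\sum_{p\ge0}\frac{a_p}{m(p)}z^p\right)=\sum_{p\ge0}\frac{a_{p+1}}{m(p)}z^p$; it acts on functions holomorphic near $0$ through their Taylor expansion at $0$, and componentwise on vectors of functions. Generalized matrix exponential. $E(Az)=\sum_{p\ge0}\frac{A^p}{m(p)}z^p$ for $A\in\mathbb{C}^{n\times n}$, which converges for all $z\in\mathbb{C}$. *)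

theory Defs
  imports "HOL-Complex_Analysis.Complex_Analysis"
begin

section \<open>Strongly regular sequences and proximate orders\<close>

definition strongly_regular :: "(nat \<Rightarrow> real) \<Rightarrow> bool" where
  "strongly_regular M \<longleftrightarrow>
     (\<forall>p. M p > 0) \<and> M 0 = 1 \<and>
     (\<forall>p\<ge>1. (M p)\<^sup>2 \<le> M (p - 1) * M (p + 1)) \<and>
     (\<exists>A>0. \<forall>p q. M (p + q) \<le> A ^ (p + q) * M p * M q) \<and>
     (\<exists>A>0. \<forall>p.
        summable (\<lambda>k. M (p + k) / (real (p + k + 1) * M (p + k + 1))) \<and>
        (\<Sum>k. M (p + k) / (real (p + k + 1) * M (p + k + 1))) \<le> A * (M p / M (p + 1)))"

text \<open>For a strongly regular sequence the supremum below is finite and the upper limit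
  in \<open>growth_order\<close> is a positive real number, so neither total operation leaves
  its meaningful range.\<close>

definition assoc_fun :: "(nat \<Rightarrow> real) \<Rightarrow> real \<Rightarrow> real" where
  "assoc_fun M t = (if t = 0 then 0 else (SUP p. ln (t ^ p / M p)))"

definition growth_order :: "(nat \<Rightarrow> real) \<Rightarrow> real" where
  "growth_order M =
     real_of_ereal (Limsup at_top (\<lambda>r. ereal (ln (assoc_fun M r) / ln r)))"

text \<open>Piecewise continuous differentiability on the unbounded interval is local: there are
  finitely many breakpoints in each compact subinterval. The limit of \<open>t \<rho>'(t) log t\<close> is
  taken over the points where the derivative exists.\<close>

definition nonzero_proximate_order :: "real \<Rightarrow> (real \<Rightarrow> real) \<Rightarrow> bool" where
  "nonzero_proximate_order c \<rho> \<longleftrightarrow>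
     c \<ge> 0 \<and> (\<forall>t>c. \<rho> t \<ge> 0) \<and>
     continuous_on {c<..} \<rho> \<and>
     (\<forall>a b. c < a \<longrightarrow> \<rho> piecewise_C1_differentiable_on {a..b}) \<and>
     (\<exists>l>0. (\<rho> \<longlongrightarrow> l) at_top) \<and>
     ((\<lambda>t. t * deriv \<rho> t * ln t) \<longlongrightarrow> 0)
       (inf at_top (principal {t. \<rho> differentiable (at t)}))"

definition admits_nonzero_proximate_order :: "(nat \<Rightarrow> real) \<Rightarrow> bool" where
  "admits_nonzero_proximate_order M \<longleftrightarrow>
     (\<exists>c \<rho> a b. nonzero_proximate_order c \<rho> \<and>
        (\<forall>\<^sub>F t in at_top. a \<le> ln t * (\<rho> t - ln (assoc_fun M t) / ln t) \<and>
                         ln t * (\<rho> t - ln (assoc_fun M t) / ln t) \<le> b))"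


section \<open>The Riemann surface of the logarithm\<close>

text \<open>A point of the surface is given by its logarithm, which is a global holomorphic
  coordinate. A subset of the punctured plane contained in the principal sheet
  \<open>\<bar>arg z\<bar> < \<pi>\<close> is thereby identified with its image under the principal logarithm, so
  that sectors of every opening are treated uniformly.\<close>

datatype log_point = Of_Log (log_of: complex)

definition lp_abs :: "log_point \<Rightarrow> real" where
  "lp_abs z = exp (Re (log_of z))"

definition lp_arg :: "log_point \<Rightarrow> real" where
  "lp_arg z = Im (log_of z)"

definition lp_proj :: "log_point \<Rightarrow> complex" where
  "lp_proj z = exp (log_of z)"

text \<open>The positive real axis in the sheet \<open>arg z = 0\<close>; only used for \<open>x > 0\<close>.\<close>

definition lp_of_real :: "real \<Rightarrow> log_point" where
  "lp_of_real x = Of_Log (complex_of_real (ln x))"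

definition lp_divide :: "log_point \<Rightarrow> log_point \<Rightarrow> log_point" where
  "lp_divide z w = Of_Log (log_of z - log_of w)"

definition lp_holomorphic_on :: "(log_point \<Rightarrow> complex) \<Rightarrow> log_point set \<Rightarrow> bool" where
  "lp_holomorphic_on f S \<longleftrightarrow> (\<lambda>w. f (Of_Log w)) holomorphic_on (log_of ` S)"

text \<open>The sector \<open>S\<^sub>d(\<theta>)\<close>, empty if \<open>\<theta> \<le> 0\<close>, and its projection to the punctured plane.\<close>

definition lp_sector :: "real \<Rightarrow> real \<Rightarrow> log_point set" where
  "lp_sector d \<theta> = {z. \<bar>lp_arg z - d\<bar> < \<theta> / 2}"

definition sector :: "real \<Rightarrow> real \<Rightarrow> complex set" where
  "sector d \<theta> = lp_proj ` lp_sector d \<theta>"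

text \<open>The disc around \<open>z\<^sub>0\<close> in the sheet of \<open>z\<^sub>0\<close>. This is a disc, not containing the origin,
  only for \<open>0 < r \<le> \<bar>z\<^sub>0\<bar>\<close>.\<close>

definition lp_disc :: "log_point \<Rightarrow> real \<Rightarrow> log_point set" where
  "lp_disc z0 r = {z. dist (lp_proj z) (lp_proj z0) < r \<and> \<bar>lp_arg z - lp_arg z0\<bar> < pi}"


section \<open>Kernels and moments\<close>

definition moment :: "(log_point \<Rightarrow> complex) \<Rightarrow> nat \<Rightarrow> complex" where
  "moment e p =
     (LINT t:{0<..}|lborel. complex_of_real (t powi (int p - 1)) * e (lp_of_real t))"

text \<open>The integral in the first condition is an extended nonnegative one, since the supremum
  over the open disc may be infinite.\<close>

definition kernel_pair ::
    "(nat \<Rightarrow> real) \<Rightarrow> (log_point \<Rightarrow> complex) \<Rightarrow> (complex \<Rightarrow> complex) \<Rightarrow> bool" where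
  "kernel_pair M e E \<longleftrightarrow>
     (let \<omega> = pi / growth_order M in
      lp_holomorphic_on e (lp_sector 0 \<omega>) \<and>
      (\<exists>t0>0. \<forall>z0 \<in> lp_sector 0 \<omega>. \<exists>r0>0.
         r0 \<le> lp_abs z0 \<and> lp_disc z0 r0 \<subseteq> lp_sector 0 \<omega> \<and>
         (\<integral>\<^sup>+ t \<in> {0<..<t0}.
            (SUP z\<in>lp_disc z0 r0. ennreal (norm (e (lp_divide (lp_of_real t) z))))
              * ennreal (1 / t) \<partial>lborel) < \<infinity>) \<and>
      (\<forall>\<delta>>0. \<exists>K1>0. \<exists>K2>0. \<forall>z \<in> lp_sector 0 (\<omega> - \<delta>).
         norm (e z) \<le> K1 * exp (- assoc_fun M (lp_abs z / K2))) \<and>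
      (\<forall>x>0. e (lp_of_real x) \<in> \<real> \<and> Re (e (lp_of_real x)) > 0) \<and>
      E holomorphic_on UNIV \<and>
      (\<exists>K3>0. \<exists>K4>0. \<forall>z. norm (E z) \<le> K3 * exp (assoc_fun M (norm z / K4))) \<and>
      (\<exists>\<beta>>0. \<forall>\<theta> R. 0 < \<theta> \<and> \<theta> < 2 * pi - \<omega> \<and> R > 0 \<longrightarrow>
         (\<exists>K5>0. \<forall>z \<in> sector pi \<theta> \<inter> (UNIV - ball 0 R).
            norm (E z) \<le> K5 / norm z powr \<beta>)) \<and>
      (\<forall>z. (\<lambda>p. z ^ p / moment e p) sums E z))"

text \<open>The moments of a kernel are positive reals, so \<open>m\<close> is a real sequence.\<close>

definition kernel_moment_sequence :: "(nat \<Rightarrow> real) \<Rightarrow> bool" where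
  "kernel_moment_sequence m \<longleftrightarrow>
     (\<exists>M e E. strongly_regular M \<and> admits_nonzero_proximate_order M \<and>
        filterlim (\<lambda>p. root p (M p)) at_top sequentially \<and>
        kernel_pair M e E \<and>
        (\<forall>p. complex_of_real (m p) = moment e p)) \<and>
     m 0 = 1 \<and> liminf (\<lambda>p. ereal (root p (m p))) = \<infinity>"


section \<open>Moment differentiation and the generalized exponential\<close>

text \<open>If \<open>f = \<Sum>p. a\<^sub>p / m(p) z\<^sup>p\<close> near the origin, then \<open>a\<^sub>p\<close> is \<open>m(p)\<close> times the Taylor coefficient.\<close>

definition moment_deriv :: "(nat \<Rightarrow> real) \<Rightarrow> (complex \<Rightarrow> complex) \<Rightarrow> complex \<Rightarrow> complex" where
  "moment_deriv m f z =
     (let a = (\<lambda>p. complex_of_real (m p) * fps_nth (fps_expansion f 0) p)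
      in \<Sum>p. a (p + 1) / complex_of_real (m p) * z ^ p)"

definition moment_deriv_vec ::
    "(nat \<Rightarrow> real) \<Rightarrow> (complex \<Rightarrow> complex ^ 'n) \<Rightarrow> complex \<Rightarrow> complex ^ 'n" where
  "moment_deriv_vec m y z = (\<chi> i. moment_deriv m (\<lambda>w. y w $ i) z)"

text \<open>Multiplication on the vector type, hence also \<open>^\<close>, is componentwise and not the matrix
  product.\<close>

definition matrix_power :: "complex ^ 'n ^ 'n \<Rightarrow> nat \<Rightarrow> complex ^ 'n ^ 'n" where
  "matrix_power A p = (((**) A) ^^ p) (mat 1)"

definition gen_matrix_exp ::
    "(nat \<Rightarrow> real) \<Rightarrow> complex ^ 'n ^ 'n \<Rightarrow> complex \<Rightarrow> complex ^ 'n ^ 'n" where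
  "gen_matrix_exp m A z =
     (\<Sum>p. map_matrix (\<lambda>x. x / complex_of_real (m p) * z ^ p) (matrix_power A p))"

definition diagonalizable :: "complex ^ 'n ^ 'n \<Rightarrow> bool" where
  "diagonalizable A \<longleftrightarrow>
     (\<exists>P D :: complex ^ 'n ^ 'n. invertible P \<and> (\<forall>i j. i \<noteq> j \<longrightarrow> D $ i $ j = 0) \<and> A = P ** D ** matrix_inv P)"

end

theory Submission
  imports Defs
begin

text \<open>Write an entire vector function as \<open>y(z) = \<Sum>p. a\<^sub>p z\<^sup>p / m(p)\<close>. Moment differentiation shifts the
  sequence \<open>a\<close>, so \<open>\<partial>\<^sub>m y = A y\<close> says that \<open>a\<^sub>p\<^sub>+\<^sub>1 = A a\<^sub>p\<close> for all \<open>p\<close>. The solutions of this recursion are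
  \<open>a\<^sub>p = A\<^sup>p v\<close> with \<open>v = a\<^sub>0\<close> arbitrary, which are the coefficients of \<open>E(Az) v\<close>. This
  comparison of coefficients is \<open>moment_ode_solutions\<close>.

  The argument rests on three facts about \<open>m\<close>, collected in
  \<open>kernel_moment_sequence_properties\<close>: the moments are positive, the series
  \<open>\<Sum>p. x\<^sup>p / m(p)\<close> converges everywhere, and \<open>m(p + 1) \<le> K C\<^sup>p m(p)\<close> for some constants. The third one
  ensures that the termwise moment derivative of an entire function is again entire; if the
  quotients \<open>m(p + 1) / m(p)\<close> grew too fast, this series could diverge off the origin.

  Convergence is part of the definition of a kernel. Positivity holds because the kernel is
  positive on the half-line and its moments are convergent integrals. For the quotients, \<open>m\<close> is
  compared with the strongly regular sequence \<open>M\<close>. The decay of \<open>e\<close> gives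
  \<open>m(p) \<le> D B\<^sup>p (1 + M\<^sub>p\<^sub>+\<^sub>1)\<close>. The growth bound for \<open>E\<close>, in which every term of the series at a positive
  point is below the sum, gives \<open>m(p) \<ge> k b\<^sup>p M\<^sub>p\<close> with \<open>k\<close> and \<open>b\<close> positive, because a log-convex
  sequence can be recovered from its associated function (\<open>exp_assoc_fun_attained\<close>).
  Moderate growth of \<open>M\<close> then bounds the quotients.\<close>

section \<open>Log-convex sequences and the associated function\<close>

lemma log_convex_ratios_mono:
  fixes M :: "nat \<Rightarrow> real"
  assumes pos: "\<And>p. M p > 0" and lc: "\<And>p. (M (Suc p))\<^sup>2 \<le> M p * M (Suc (Suc p))"
  shows "incseq (\<lambda>p. M (Suc p) / M p)"
proof (rule incseq_SucI)
  fix p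
  show "M (Suc p) / M p \<le> M (Suc (Suc p)) / M (Suc p)"
    using pos[of p] pos[of "Suc p"] lc[of p]
    by (simp add: field_simps power2_eq_square)
qed

text \<open>Dividing \<open>r\<^sub>p\<^sup>q / M\<^sub>q\<close> by its neighbour with index \<open>q - 1\<close> gives \<open>r\<^sub>p / r\<^sub>q\<^sub>-\<^sub>1\<close>, which is at
  least one for \<open>q \<le> p\<close> and at most one for \<open>q > p\<close>. So for \<open>t = r\<^sub>p\<close> the quantity \<open>t\<^sup>q / M\<^sub>q\<close> is
  maximal at \<open>q = p\<close>.\<close>

lemma log_convex_touches_power:
  fixes M :: "nat \<Rightarrow> real"
  assumes pos: "\<And>p. M p > 0" and lc: "\<And>p. (M (Suc p))\<^sup>2 \<le> M p * M (Suc (Suc p))"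
  defines "r \<equiv> \<lambda>p. M (Suc p) / M p"
  shows "r p ^ q / M q \<le> r p ^ p / M p"
proof -
  have r_pos: "r k > 0" for k using pos by (simp add: r_def)
  have mono: "r i \<le> r j" if "i \<le> j" for i j
    using incseqD[OF log_convex_ratios_mono[of M, OF pos lc] that] by (simp add: r_def)
  have step: "M (Suc k) = r k * M k" for k using pos[of k] by (simp add: r_def)
  have "r p ^ p / M p \<ge> r p ^ (p + k) / M (p + k)" for k
  proof (induction k)
    case (Suc k)
    have "r p ^ (p + Suc k) / M (p + Suc k) = (r p / r (p + k)) * (r p ^ (p + k) / M (p + k))"
      by (simp add: step)
    also have "\<dots> \<le> 1 * (r p ^ (p + k) / M (p + k))"
      using mono[of p "p + k"] r_pos[of "p + k"] r_pos[of p] pos[of "p + k"]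
      by (intro mult_right_mono) auto
    finally show ?case using Suc by simp
  qed simp
  moreover have "r p ^ p / M p \<ge> r p ^ (p - k) / M (p - k)" if "k \<le> p" for k
    using that
  proof (induction k)
    case (Suc k)
    define j where "j = p - Suc k"
    have j: "p - k = Suc j" using Suc.prems by (simp add: j_def)
    have "1 * (r p ^ j / M j) \<le> (r p / r j) * (r p ^ j / M j)"
      using mono[of j p] r_pos[of j] r_pos[of p] pos[of j] 
      by (intro mult_right_mono) (auto simp: j_def)
    also have "\<dots> = r p ^ (p - k) / M (p - k)" by (simp add: j step)
    finally show ?case using Suc by (simp add: j_def)
  qed simp
  ultimately show ?thesis
    by (cases "q \<ge> p") (metis le_add_diff_inverse, metis diff_diff_cancel diff_le_self nat_le_linear)
qed

text \<open>The case \<open>p = 0\<close> of the previous lemma, with touching point \<open>t = M\<^sub>1 / M\<^sub>0\<close>.\<close>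

lemma log_convex_geometric_lower_bound:
  fixes M :: "nat \<Rightarrow> real"
  assumes pos: "\<And>p. M p > 0" and lc: "\<And>p. (M (Suc p))\<^sup>2 \<le> M p * M (Suc (Suc p))"
    and M0: "M 0 = 1"
  shows "M 1 ^ p \<le> M p"
  using log_convex_touches_power[of M, OF pos lc, of 0 p] pos[of p] M0
  by (simp add: divide_le_eq)

text \<open>Once \<open>t \<le> M\<^sub>p\<^sup>1\<^sup>/\<^sup>p\<close> the logarithm is at most zero, and only finitely many indices remain.
  Without this the supremum in the associated function would carry no information.\<close>

lemma assoc_fun_bdd_above:
  fixes M :: "nat \<Rightarrow> real"
  assumes pos: "\<And>p. M p > 0"
    and lim: "filterlim (\<lambda>p. root p (M p)) at_top sequentially" and t: "t > 0"
  shows "bdd_above (range (\<lambda>p. ln (t ^ p / M p)))"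
proof -
  obtain N where N: "\<And>p. p \<ge> N \<Longrightarrow> t \<le> root p (M p)"
    using filterlim_at_top[THEN iffD1, OF lim, rule_format, of t]
    by (auto simp: eventually_sequentially)
  have "ln (t ^ p / M p) \<le> 0" if "p \<ge> Suc N" for p
  proof -
    have "t ^ p \<le> root p (M p) ^ p" using N[of p] that t by (intro power_mono) auto
    also have "\<dots> = M p" using that pos[of p] by (intro real_root_pow_pos2) auto
    finally show ?thesis using t pos[of p] by simp
  qed
  then have "range (\<lambda>p. ln (t ^ p / M p)) \<subseteq> (\<lambda>p. ln (t ^ p / M p)) ` {..N} \<union> {..0}"
    by (force simp: not_less_eq_eq)
  moreover have "bdd_above ((\<lambda>p. ln (t ^ p / M p)) ` {..N} \<union> {..0::real})"
    by (intro bdd_above_Un[THEN iffD2] conjI) auto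
  ultimately show ?thesis by (rule bdd_above_mono[rotated])
qed

text \<open>This turns the exponential decay of the kernel into decay of every polynomial order, with a
  constant given by \<open>M\<close>.\<close>

lemma exp_minus_assoc_fun_le:
  fixes M :: "nat \<Rightarrow> real"
  assumes pos: "\<And>p. M p > 0"
    and lim: "filterlim (\<lambda>p. root p (M p)) at_top sequentially" and t: "t > 0"
  shows "exp (- assoc_fun M t) \<le> M p / t ^ p"
proof -
  have "ln (t ^ p / M p) \<le> assoc_fun M t"
    using cSUP_upper[OF _ assoc_fun_bdd_above[OF assms], of p] t by (simp add: assoc_fun_def)
  then have "exp (- assoc_fun M t) \<le> exp (- ln (t ^ p / M p))" by simp
  also have "\<dots> = M p / t ^ p" using t pos[of p] by (simp add: exp_minus)
  finally show ?thesis .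
qed

text \<open>One half of Mandelbrojt's formula \<open>M\<^sub>p = sup\<^sub>t t\<^sup>p exp (- M(t))\<close>: the associated function is a
  Legendre transform, and for a log-convex sequence no information is lost in it.\<close>

lemma exp_assoc_fun_attained:
  fixes M :: "nat \<Rightarrow> real"
  assumes pos: "\<And>p. M p > 0" and lc: "\<And>p. (M (Suc p))\<^sup>2 \<le> M p * M (Suc (Suc p))"
  shows "\<exists>t>0. exp (assoc_fun M t) \<le> t ^ p / M p"
proof -
  define t where "t = M (Suc p) / M p"
  have t: "t > 0" using pos by (simp add: t_def)
  have "ln (t ^ q / M q) \<le> ln (t ^ p / M p)" for q
    using log_convex_touches_power[of M, OF pos lc, of p q] t pos[of p] pos[of q]
    by (subst ln_le_cancel_iff) (auto simp: t_def)
  then have "assoc_fun M t \<le> ln (t ^ p / M p)"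
    using t by (simp add: assoc_fun_def cSUP_least)
  then have "exp (assoc_fun M t) \<le> exp (ln (t ^ p / M p))" by simp
  with t pos[of p] show ?thesis by auto
qed

section \<open>The growth order\<close>

text \<open>The difference \<open>\<rho>(t) - log M(t) / log t\<close> is bounded by a multiple of \<open>1 / log t\<close>, so the
  upper limit that defines the growth order is in fact the limit of \<open>\<rho>\<close>. Positivity makes the
  sector of the kernel a neighbourhood of the positive real axis; for an empty sector the
  conditions on \<open>e\<close> in the sector would say nothing.\<close>

lemma growth_order_pos:
  assumes "admits_nonzero_proximate_order M"
  shows "growth_order M > 0"
proof -
  obtain c \<rho> a b l where l: "l > 0" "(\<rho> \<longlongrightarrow> l) at_top"
    and ev: "\<forall>\<^sub>F t in at_top. a \<le> ln t * (\<rho> t - ln (assoc_fun M t) / ln t) \<and>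
                         ln t * (\<rho> t - ln (assoc_fun M t) / ln t) \<le> b"
    using assms unfolding admits_nonzero_proximate_order_def nonzero_proximate_order_def by blast
  have ln0: "((\<lambda>t. k / ln t) \<longlongrightarrow> 0) at_top" for k :: real
    by (intro tendsto_divide_0[OF tendsto_const] filterlim_at_top_imp_at_infinity ln_at_top)
  have diff: "((\<lambda>t. \<rho> t - ln (assoc_fun M t) / ln t) \<longlongrightarrow> 0) at_top"
  proof (rule tendsto_sandwich[OF _ _ ln0[of a] ln0[of b]])
    show "\<forall>\<^sub>F t in at_top. a / ln t \<le> \<rho> t - ln (assoc_fun M t) / ln t"
      using ev eventually_gt_at_top[of 1]
      by eventually_elim (simp add: pos_divide_le_eq mult.commute)
    show "\<forall>\<^sub>F t in at_top. \<rho> t - ln (assoc_fun M t) / ln t \<le> b / ln t"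
      using ev eventually_gt_at_top[of 1]
      by eventually_elim (simp add: pos_le_divide_eq mult.commute)
  qed
  have "((\<lambda>t. ln (assoc_fun M t) / ln t) \<longlongrightarrow> l) at_top"
    using tendsto_diff[OF l(2) diff] by simp
  then have "((\<lambda>t. ereal (ln (assoc_fun M t) / ln t)) \<longlongrightarrow> ereal l) at_top" by simp
  then have "Limsup at_top (\<lambda>t. ereal (ln (assoc_fun M t) / ln t)) = ereal l"
    by (intro lim_imp_Limsup) auto
  with l(1) show ?thesis by (simp add: growth_order_def)
qed

section \<open>Moments of a kernel\<close>

text \<open>The integrand is compared with \<open>t0\<^sup>p f(t) / t\<close> to the left of \<open>t0\<close> and with \<open>c / t\<^sup>2\<close> to the right of
  it. Integrability has to be proved along with the estimate, because the integral of a
  function that is not integrable is zero by convention.\<close>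

lemma moment_integral_bound:
  fixes f :: "real \<Rightarrow> real"
  assumes cont: "continuous_on {0<..} f" and nonneg: "\<And>t. t > 0 \<Longrightarrow> f t \<ge> 0"
    and t0: "t0 > 0" and I: "I \<ge> 0" "(\<integral>\<^sup>+ t \<in> {0<..<t0}. ennreal (f t / t) \<partial>lborel) \<le> ennreal I"
    and c: "c \<ge> 0" "\<And>t. t \<ge> t0 \<Longrightarrow> f t \<le> c / t ^ Suc p"
  shows "set_integrable lborel {0<..} (\<lambda>t. t powi (int p - 1) * f t)"
    and "(LINT t:{0<..}|lborel. t powi (int p - 1) * f t) \<le> t0 ^ p * I + c / t0"
proof -
  define g where "g t = indicator {0<..} t *\<^sub>R (t powi (int p - 1) * f t)" for t
  have g_eq: "g t = t ^ p * (f t / t)" if "t > 0" for t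
    using that by (simp add: g_def power_int_diff)
  have g_neg: "g t = 0" if "\<not> t > 0" for t using that by (simp add: g_def)
  have g_nonneg: "g t \<ge> 0" for t
    using nonneg[of t] by (cases "t > 0") (auto simp: g_eq g_neg)
  have meas: "g \<in> borel_measurable lborel"
    unfolding g_def measurable_lborel2
    by (intro borel_measurable_continuous_on_indicator continuous_intros cont) auto
  have measf: "(\<lambda>t. f t / t * indicator {0<..<t0} t) \<in> borel_measurable lborel"
  proof -
    have "(\<lambda>t. indicator {0<..<t0} t *\<^sub>R (f t / t)) \<in> borel_measurable borel"
      by (intro borel_measurable_continuous_on_indicator continuous_intros
            continuous_on_subset[OF cont]) auto
    then show ?thesis by (simp add: mult.commute)
  qed
  have tail: "(\<integral>\<^sup>+t. ennreal (c / t\<^sup>2) * indicator {t0..} t \<partial>lborel) = ennreal (0 - - c / t0)"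
  proof (rule nn_integral_FTC_atLeast)
    show "((\<lambda>t. - c / t) has_real_derivative c / x\<^sup>2) (at x)" if "t0 \<le> x" for x
      using that t0 by (auto intro!: derivative_eq_intros simp: power2_eq_square)
    show "((\<lambda>t. - c / t) \<longlongrightarrow> 0) at_top"
      by (intro tendsto_divide_0[OF tendsto_const] filterlim_at_top_imp_at_infinity filterlim_ident)
  qed (use c in \<open>auto simp: measurable_lborel2\<close>)
  have "(\<integral>\<^sup>+t. ennreal (g t) \<partial>lborel)
      \<le> (\<integral>\<^sup>+t. ennreal (t0 ^ p) * (ennreal (f t / t) * indicator {0<..<t0} t)
               + ennreal (c / t\<^sup>2) * indicator {t0..} t \<partial>lborel)"
  proof (rule nn_integral_mono)
    fix t :: real
    consider "t \<le> 0" | "0 < t" "t < t0" | "t0 \<le> t" by linarith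
    then show "ennreal (g t) \<le> ennreal (t0 ^ p) * (ennreal (f t / t) * indicator {0<..<t0} t)
               + ennreal (c / t\<^sup>2) * indicator {t0..} t"
    proof cases
      case 2
      have "g t \<le> t0 ^ p * (f t / t)"
        using 2 nonneg[of t] unfolding g_eq[OF 2(1)] by (intro mult_right_mono power_mono) auto
      then show ?thesis using 2 t0 nonneg[of t]
        by (simp add: ennreal_mult'[symmetric] ennreal_leI)
    next
      case 3
      then have t: "t > 0" using t0 by simp
      have "g t \<le> t ^ p * (c / t ^ Suc p / t)"
        using c(2)[OF 3] t unfolding g_eq[OF t] by (intro mult_left_mono divide_right_mono) auto
      also have "\<dots> = c / t\<^sup>2" using t by (simp add: field_simps power2_eq_square)
      finally show ?thesis using 3 by (simp add: ennreal_leI)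
    qed (simp add: g_neg)
  qed
  also have "\<dots> = ennreal (t0 ^ p) * (\<integral>\<^sup>+ t \<in> {0<..<t0}. ennreal (f t / t) \<partial>lborel) + ennreal (c / t0)"
  proof -
    have "(\<lambda>t. ennreal (f t / t * indicator {0<..<t0} t)) \<in> borel_measurable lborel"
      using measf by simp
    then have m: "(\<lambda>t. ennreal (f t / t) * indicator {0<..<t0} t) \<in> borel_measurable lborel"
      by (rule measurable_cong[THEN iffD1, rotated]) (auto split: split_indicator)
    show ?thesis using m
      by (subst nn_integral_add) (auto simp: nn_integral_cmult tail)
  qed
  also have "\<dots> \<le> ennreal (t0 ^ p) * ennreal I + ennreal (c / t0)"
    by (intro add_mono mult_left_mono I) auto
  also have "\<dots> = ennreal (t0 ^ p * I + c / t0)"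
    using t0 I c by (simp add: ennreal_mult)
  finally have bound: "(\<integral>\<^sup>+t. ennreal (g t) \<partial>lborel) \<le> ennreal (t0 ^ p * I + c / t0)" .
  have int: "integrable lborel g"
    using bound meas g_nonneg by (intro integrableI_nonneg) (auto simp: top_unique less_top[symmetric])
  then show "set_integrable lborel {0<..} (\<lambda>t. t powi (int p - 1) * f t)"
    by (simp only: set_integrable_def g_def[abs_def])
  have "ennreal (integral\<^sup>L lborel g) \<le> ennreal (t0 ^ p * I + c / t0)"
    using bound nn_integral_eq_integral[OF int] g_nonneg by simp
  then have "integral\<^sup>L lborel g \<le> t0 ^ p * I + c / t0"
    using t0 I c by (subst (asm) ennreal_le_iff) auto
  then show "(LINT t:{0<..}|lborel. t powi (int p - 1) * f t) \<le> t0 ^ p * I + c / t0"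
    by (simp add: set_lebesgue_integral_def g_def[abs_def])
qed

lemma set_integral_pos_half_line:
  fixes g :: "real \<Rightarrow> real"
  assumes int: "set_integrable lborel {0<..} g" and pos: "\<And>t. t > 0 \<Longrightarrow> g t > 0"
  shows "(LINT t:{0<..}|lborel. g t) > 0"
proof -
  let ?g = "\<lambda>t. indicator {0<..} t *\<^sub>R g t"
  have nonneg: "?g t \<ge> 0" for t using pos[of t] by (auto split: split_indicator)
  have "integral\<^sup>L lborel ?g \<noteq> 0"
  proof
    assume "integral\<^sup>L lborel ?g = 0"
    then have "AE t in lborel. ?g t = 0"
      using int nonneg by (subst (asm) integral_nonneg_eq_0_iff_AE) (auto simp: set_integrable_def)
    then have "AE t in lborel. t \<notin> {0<..<1::real}"
      by eventually_elim (use pos in \<open>force split: split_indicator_asm\<close>)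
    then have "emeasure lborel {0<..<1::real} = 0"
      by (subst (asm) AE_iff_measurable[of "{0<..<1}"]) auto
    then show False by simp
  qed
  moreover have "integral\<^sup>L lborel ?g \<ge> 0" using nonneg by (rule Bochner_Integration.integral_nonneg)
  ultimately show ?thesis by (simp add: set_lebesgue_integral_def)
qed

lemma strongly_regularD:
  assumes "strongly_regular M"
  shows "M p > 0" "M 0 = 1" "(M (Suc p))\<^sup>2 \<le> M p * M (Suc (Suc p))"
    "\<exists>A>0. \<forall>p q. M (p + q) \<le> A ^ (p + q) * M p * M q"
proof -
  show "(M (Suc p))\<^sup>2 \<le> M p * M (Suc (Suc p))"
    using assms unfolding strongly_regular_def by (elim conjE allE[of _ "Suc p"]) simp
qed (use assms in \<open>simp_all add: strongly_regular_def\<close>)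

text \<open>The moments only see the kernel on the positive axis. The local
  integrability condition is used for the single point \<open>z0 = 1\<close> of the sector, where the
  supremum over the disc dominates \<open>\<bar>e(t)\<bar>\<close>, the value at its centre; the decay condition is
  used on the sector of half the opening.\<close>

lemma kernel_on_positive_axis:
  assumes ker: "kernel_pair M e E" and gr: "growth_order M > 0"
  defines "f \<equiv> \<lambda>t. Re (e (lp_of_real t))"
  shows "t > 0 \<Longrightarrow> e (lp_of_real t) = complex_of_real (f t)"
    and "t > 0 \<Longrightarrow> f t > 0"
    and "continuous_on {0<..} f"
    and "\<exists>t0>0. \<exists>I\<ge>0. (\<integral>\<^sup>+ t \<in> {0<..<t0}. ennreal (f t / t) \<partial>lborel) \<le> ennreal I"
    and "\<exists>K1>0. \<exists>K2>0. \<forall>t>0. f t \<le> K1 * exp (- assoc_fun M (t / K2))"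
proof -
  define \<omega> where "\<omega> = pi / growth_order M"
  have \<omega>: "\<omega> > 0" using gr by (simp add: \<omega>_def)
  note K = ker[unfolded kernel_pair_def Let_def, folded \<omega>_def]
  have hol: "lp_holomorphic_on e (lp_sector 0 \<omega>)"
    and near0: "\<exists>t0>0. \<forall>z0 \<in> lp_sector 0 \<omega>. \<exists>r0>0.
         r0 \<le> lp_abs z0 \<and> lp_disc z0 r0 \<subseteq> lp_sector 0 \<omega> \<and>
         (\<integral>\<^sup>+ t \<in> {0<..<t0}.
            (SUP z\<in>lp_disc z0 r0. ennreal (norm (e (lp_divide (lp_of_real t) z))))
              * ennreal (1 / t) \<partial>lborel) < \<infinity>"
    and decay: "\<forall>\<delta>>0. \<exists>K1>0. \<exists>K2>0. \<forall>z \<in> lp_sector 0 (\<omega> - \<delta>).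
         norm (e z) \<le> K1 * exp (- assoc_fun M (lp_abs z / K2))"
    and real: "\<forall>x>0. e (lp_of_real x) \<in> \<real> \<and> Re (e (lp_of_real x)) > 0"
    by (insert K) (elim conjE, assumption)+
  show e_eq: "e (lp_of_real t) = complex_of_real (f t)" if "t > 0" for t
    using real that by (simp add: f_def)
  show f_pos: "f t > 0" if "t > 0" for t
    using real that by (simp add: f_def)
  have norm_e: "norm (e (lp_of_real t)) = f t" if "t > 0" for t
    using e_eq[OF that] f_pos[OF that] by simp
  show "continuous_on {0<..} f"
  proof -
    have "continuous_on (log_of ` lp_sector 0 \<omega>) (\<lambda>w. e (Of_Log w))"
      using hol unfolding lp_holomorphic_on_def by (rule holomorphic_on_imp_continuous_on)
    moreover have "continuous_on {0<..} (\<lambda>t. complex_of_real (ln t))"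
      by (intro continuous_intros) auto
    moreover have "(\<lambda>t. complex_of_real (ln t)) ` {0<..} \<subseteq> log_of ` lp_sector 0 \<omega>"
    proof (rule image_subsetI)
      fix t :: real
      have "Of_Log (complex_of_real (ln t)) \<in> lp_sector 0 \<omega>"
        using \<omega> by (simp add: lp_sector_def lp_arg_def)
      then show "complex_of_real (ln t) \<in> log_of ` lp_sector 0 \<omega>" by (rule rev_image_eqI) simp
    qed
    ultimately have "continuous_on {0<..} (\<lambda>t. e (Of_Log (complex_of_real (ln t))))"
      by (rule continuous_on_compose2)
    then show ?thesis unfolding f_def lp_of_real_def by (intro continuous_intros)
  qed
  show "\<exists>t0>0. \<exists>I\<ge>0. (\<integral>\<^sup>+ t \<in> {0<..<t0}. ennreal (f t / t) \<partial>lborel) \<le> ennreal I"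
  proof -
    have "Of_Log 0 \<in> lp_sector 0 \<omega>" using \<omega> by (simp add: lp_sector_def lp_arg_def)
    with near0 have "\<exists>t0>0. \<exists>r0>0. (\<integral>\<^sup>+ t \<in> {0<..<t0}.
            (SUP z\<in>lp_disc (Of_Log 0) r0. ennreal (norm (e (lp_divide (lp_of_real t) z))))
              * ennreal (1 / t) \<partial>lborel) < \<infinity>"
      by meson
    then obtain t0 r0 where t0: "t0 > 0" and r0: "r0 > 0"
      and fin: "(\<integral>\<^sup>+ t \<in> {0<..<t0}.
            (SUP z\<in>lp_disc (Of_Log 0) r0. ennreal (norm (e (lp_divide (lp_of_real t) z))))
              * ennreal (1 / t) \<partial>lborel) < \<infinity>" (is "?J < \<infinity>")
      by blast
    have "(\<integral>\<^sup>+ t \<in> {0<..<t0}. ennreal (f t / t) \<partial>lborel) \<le> ?J"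
    proof (rule nn_integral_mono)
      fix t :: real
      show "ennreal (f t / t) * indicator {0<..<t0} t
          \<le> (SUP z\<in>lp_disc (Of_Log 0) r0. ennreal (norm (e (lp_divide (lp_of_real t) z))))
              * ennreal (1 / t) * indicator {0<..<t0} t"
      proof (cases "t > 0")
        case True
        have "ennreal (f t) \<le> (SUP z\<in>lp_disc (Of_Log 0) r0. ennreal (norm (e (lp_divide (lp_of_real t) z))))"
        proof (rule SUP_upper2)
          show "Of_Log 0 \<in> lp_disc (Of_Log 0) r0" using r0 by (simp add: lp_disc_def)
          show "ennreal (f t) \<le> ennreal (norm (e (lp_divide (lp_of_real t) (Of_Log 0))))"
            using norm_e[OF True] by (simp add: lp_divide_def)
        qed
        moreover have "ennreal (f t / t) = ennreal (f t) * ennreal (1 / t)"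
          using True f_pos[OF True] by (simp flip: ennreal_mult)
        ultimately show ?thesis by (simp add: mult_right_mono)
      qed simp
    qed
    with fin have "(\<integral>\<^sup>+ t \<in> {0<..<t0}. ennreal (f t / t) \<partial>lborel) < \<infinity>"
      by (rule le_less_trans[rotated])
    then have "(\<integral>\<^sup>+ t \<in> {0<..<t0}. ennreal (f t / t) \<partial>lborel)
        \<le> ennreal (enn2real (\<integral>\<^sup>+ t \<in> {0<..<t0}. ennreal (f t / t) \<partial>lborel))"
      by (intro eq_refl ennreal_enn2real[symmetric]) (simp add: infinity_ennreal_def)
    with t0 show ?thesis using enn2real_nonneg by blast
  qed
  show "\<exists>K1>0. \<exists>K2>0. \<forall>t>0. f t \<le> K1 * exp (- assoc_fun M (t / K2))"
  proof -
    from decay[rule_format, of "\<omega> / 2"] \<omega> obtain K1 K2 where K12: "K1 > 0" "K2 > 0"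
      and le: "\<forall>z \<in> lp_sector 0 (\<omega> - \<omega> / 2). norm (e z) \<le> K1 * exp (- assoc_fun M (lp_abs z / K2))"
      by auto
    have "f t \<le> K1 * exp (- assoc_fun M (t / K2))" if t: "t > 0" for t
    proof -
      have "lp_of_real t \<in> lp_sector 0 (\<omega> - \<omega> / 2)" "lp_abs (lp_of_real t) = t"
        using t \<omega> by (simp_all add: lp_sector_def lp_arg_def lp_of_real_def lp_abs_def)
      then show ?thesis using le norm_e[OF t] by force
    qed
    with K12 show ?thesis by blast
  qed
qed

text \<open>The \<open>p\<close>-th moment needs decay of order \<open>t\<^sup>-\<^sup>(\<^sup>p\<^sup>+\<^sup>1\<^sup>)\<close> at infinity, which is why \<open>M (Suc p)\<close> and not
  \<open>M p\<close> appears; the summand \<open>1\<close> accounts for the integral near the origin. Positivity of the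
  moments is what allows division by them in all power series.\<close>

lemma kernel_moments_pos_and_upper_bound:
  assumes reg: "strongly_regular M" and lim: "filterlim (\<lambda>p. root p (M p)) at_top sequentially"
    and ker: "kernel_pair M e E" and gr: "growth_order M > 0"
    and m: "\<And>p. complex_of_real (m p) = moment e p"
  shows "m p > 0" and "\<exists>D\<ge>0. \<exists>B>0. \<forall>p. m p \<le> D * B ^ p * (1 + M (Suc p))"
proof -
  define f where "f t = Re (e (lp_of_real t))" for t
  note f = kernel_on_positive_axis[OF ker gr, folded f_def]
  obtain t0 I where t0: "t0 > 0" and I: "I \<ge> 0"
    "(\<integral>\<^sup>+ t \<in> {0<..<t0}. ennreal (f t / t) \<partial>lborel) \<le> ennreal I"
    using f(4) by blast
  obtain K1 K2 where K: "K1 > 0" "K2 > 0"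
    and decay: "\<And>t. t > 0 \<Longrightarrow> f t \<le> K1 * exp (- assoc_fun M (t / K2))"
    using f(5) by blast
  note Mpos = strongly_regularD(1)[OF reg]
  define c where "c p = K1 * M (Suc p) * K2 ^ Suc p" for p
  have c0: "c p \<ge> 0" for p using K Mpos[of "Suc p"] by (simp add: c_def)
  have tail: "f t \<le> c p / t ^ Suc p" if "t \<ge> t0" for t p
  proof -
    have t: "t > 0" using that t0 by simp
    have "f t \<le> K1 * exp (- assoc_fun M (t / K2))" by (rule decay[OF t])
    also have "\<dots> \<le> K1 * (M (Suc p) / (t / K2) ^ Suc p)"
      using K t exp_minus_assoc_fun_le[OF Mpos lim, of "t / K2" "Suc p"] by (intro mult_left_mono) auto
    also have "\<dots> = c p / t ^ Suc p" using K t by (simp add: c_def power_divide)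
    finally show ?thesis .
  qed
  note bnd = moment_integral_bound[OF f(3) less_imp_le[OF f(2)] t0 I c0 tail]
  have m_eq: "m p = (LINT t:{0<..}|lborel. t powi (int p - 1) * f t)" for p
  proof -
    have "complex_of_real (m p)
        = (LINT t:{0<..}|lborel. complex_of_real (t powi (int p - 1) * f t))"
      unfolding m moment_def by (rule set_lebesgue_integral_cong) (auto simp: f(1))
    then show ?thesis by (simp only: set_integral_complex_of_real of_real_eq_iff)
  qed
  show "m p > 0"
    unfolding m_eq by (rule set_integral_pos_half_line[OF bnd(1)]) (auto intro!: mult_pos_pos zero_less_power_int f(2))
  define B where "B = max t0 K2"
  define D where "D = max I (K1 * K2 / t0)"
  have D: "D \<ge> 0" using I by (simp add: D_def le_max_iff_disj)
  have "m p \<le> D * B ^ p * (1 + M (Suc p))" for p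
  proof -
    have "m p \<le> t0 ^ p * I + c p / t0" unfolding m_eq by (rule bnd(2))
    also have "c p / t0 = K2 ^ p * (K1 * K2 / t0) * M (Suc p)" by (simp add: c_def)
    also have "t0 ^ p * I + K2 ^ p * (K1 * K2 / t0) * M (Suc p) \<le> B ^ p * D + B ^ p * D * M (Suc p)"
      using t0 K I Mpos[of "Suc p"] D
      by (intro add_mono mult_mono mult_right_mono power_mono) (auto simp: B_def D_def)
    finally show ?thesis by (simp add: algebra_simps)
  qed
  moreover have "B > 0" using t0 by (simp add: B_def)
  ultimately show "\<exists>D\<ge>0. \<exists>B>0. \<forall>p. m p \<le> D * B ^ p * (1 + M (Suc p))"
    using D by blast
qed

lemma kernel_exponential_sums_real:
  assumes ker: "kernel_pair M e E" and m: "\<And>p. complex_of_real (m p) = moment e p"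
  shows "(\<lambda>p. x ^ p / m p) sums Re (E (complex_of_real x))"
proof -
  have series: "(\<lambda>p. z ^ p / complex_of_real (m p)) sums E z" for z
    using ker unfolding kernel_pair_def Let_def m by (elim conjE allE)
  show ?thesis
    using sums_Re[OF series[of "complex_of_real x"]]
    by (simp flip: of_real_power of_real_divide)
qed

text \<open>All terms of \<open>E(x) = \<Sum>q. x\<^sup>q / m(q)\<close> are positive for \<open>x > 0\<close>, so a single one is bounded by
  \<open>E(x)\<close>, hence by \<open>K3 exp (M(x / K4))\<close>. The bound is then evaluated at
  \<open>x = K4 t\<close>, where \<open>t\<close> is a point with \<open>exp (M(t)) \<le> t\<^sup>p / M\<^sub>p\<close>.\<close>

lemma kernel_moments_lower_bound:
  assumes reg: "strongly_regular M" and ker: "kernel_pair M e E"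
    and m: "\<And>p. complex_of_real (m p) = moment e p" and mpos: "\<And>p. m p > 0"
  shows "\<exists>K3>0. \<exists>K4>0. \<forall>p. K4 ^ p * M p \<le> K3 * m p"
proof -
  note real_series = kernel_exponential_sums_real[of M e E m, OF ker m]
  have "\<exists>K3>0. \<exists>K4>0. \<forall>z. norm (E z) \<le> K3 * exp (assoc_fun M (norm z / K4))"
    using ker unfolding kernel_pair_def Let_def by (elim conjE)
  then obtain K3 K4 where K: "K3 > 0" "K4 > 0"
    and E: "\<And>z. norm (E z) \<le> K3 * exp (assoc_fun M (norm z / K4))"
    by blast
  have "K4 ^ p * M p \<le> K3 * m p" for p
  proof -
    obtain t where t: "t > 0" "exp (assoc_fun M t) \<le> t ^ p / M p"
      using exp_assoc_fun_attained[of M p, OF strongly_regularD(1,3)[OF reg]] by blast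
    define x where "x = K4 * t"
    have x: "x > 0" using t K by (simp add: x_def)
    have norm_x: "norm (complex_of_real x) / K4 = t" using t(1) K by (simp add: x_def norm_mult)
    have "x ^ p / m p \<le> (\<Sum>q. x ^ q / m q)"
      using real_series x mpos
      by (intro sum_le_suminf[of _ "{p}", simplified]) (auto intro: sums_summable simp: less_imp_le)
    also have "\<dots> = Re (E (complex_of_real x))" by (rule sums_unique[OF real_series, symmetric])
    also have "\<dots> \<le> norm (E (complex_of_real x))" by (rule complex_Re_le_cmod)
    also have "\<dots> \<le> K3 * exp (assoc_fun M t)" 
      using E[of "complex_of_real x"] norm_x by simp
    also have "\<dots> \<le> K3 * (t ^ p / M p)" using t K by (intro mult_left_mono) auto
    finally have "t ^ p * (K4 ^ p / m p) \<le> t ^ p * (K3 / M p)"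
      by (simp add: x_def power_mult_distrib mult_ac)
    then have "K4 ^ p / m p \<le> K3 / M p"
      by (rule mult_left_le_imp_le) (use t(1) in simp)
    then show ?thesis
      using mpos[of p] strongly_regularD(1)[OF reg, of p] by (simp add: divide_simps)
  qed
  with K show "\<exists>K3>0. \<exists>K4>0. \<forall>p. K4 ^ p * M p \<le> K3 * m p" by blast
qed

text \<open>Everything the differential system needs to know about the moments. The third property is
  obtained by comparing \<open>m\<close> with \<open>M\<close> from both sides; the upper bound for \<open>m (Suc p)\<close>
  involves \<open>M (p + 2)\<close>, which moderate growth reduces to \<open>M p\<close> at the cost of a geometric
  factor.\<close>

lemma kernel_moment_sequence_properties:
  assumes "kernel_moment_sequence m"
  shows "m p > 0" and "summable (\<lambda>p. x ^ p / m p)"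
    and "\<exists>K\<ge>0. \<exists>C\<ge>0. \<forall>p. m (Suc p) \<le> K * C ^ p * m p"
proof -
  obtain M e E where reg: "strongly_regular M" and adm: "admits_nonzero_proximate_order M"
    and lim: "filterlim (\<lambda>p. root p (M p)) at_top sequentially"
    and ker: "kernel_pair M e E" and m: "\<And>p. complex_of_real (m p) = moment e p"
    using assms unfolding kernel_moment_sequence_def by blast
  note up = kernel_moments_pos_and_upper_bound[OF reg lim ker growth_order_pos[OF adm] m]
  show mpos: "m p > 0" for p by (rule up(1))
  show "summable (\<lambda>p. x ^ p / m p)"
    by (rule sums_summable[OF kernel_exponential_sums_real[of M e E m, OF ker m]])
  obtain D B where D: "D \<ge> 0" "B > 0" and upper: "\<And>p. m p \<le> D * B ^ p * (1 + M (Suc p))"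
    using up(2) by blast
  obtain K3 K4 where K: "K3 > 0" "K4 > 0" and lower: "\<And>p. K4 ^ p * M p \<le> K3 * m p"
    using kernel_moments_lower_bound[OF reg ker m mpos] by blast
  obtain A where A: "A > 0" "\<And>p q. M (p + q) \<le> A ^ (p + q) * M p * M q"
    using strongly_regularD(4)[OF reg] by blast
  note Mpos = strongly_regularD(1)[OF reg]
  \<comment> \<open>The base \<open>1 / M 1\<close> absorbs the summand \<open>1\<close> of the upper bound, as \<open>1 \<le> (1 / M 1)\<^sup>p M\<^sub>p\<close>.\<close>
  define a where "a = max A (1 / M 1)"
  define L where "L = 1 + A\<^sup>2 * M 2"
  have a: "a > 0" using A by (simp add: a_def)
  have L: "L > 0" using A Mpos[of 2] by (simp add: L_def add_pos_pos)
  have shift: "1 + M (Suc (Suc p)) \<le> L * a ^ p * M p" for p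
  proof -
    have "M 1 \<noteq> 0" using Mpos[of 1] by linarith
    then have "1 = (1 / M 1) ^ p * M 1 ^ p"
      by (simp flip: power_mult_distrib)
    also have "\<dots> \<le> a ^ p * M p"
    proof (rule mult_mono)
      show "(1 / M 1) ^ p \<le> a ^ p"
        using Mpos[of 1] by (intro power_mono) (simp_all add: a_def del: One_nat_def)
      show "M 1 ^ p \<le> M p"
        by (rule log_convex_geometric_lower_bound[of M, OF strongly_regularD(1,3,2)[OF reg]])
    qed (use a Mpos[of 1] in \<open>simp_all del: One_nat_def\<close>)
    finally have 1: "1 \<le> a ^ p * M p" .
    have "M (Suc (Suc p)) \<le> A ^ p * (A\<^sup>2 * M p * M 2)"
      using A(2)[of p 2] by (simp add: power_add mult_ac power2_eq_square)
    also have "\<dots> \<le> a ^ p * (A\<^sup>2 * M p * M 2)"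
      using A Mpos[of p] Mpos[of 2] by (intro mult_right_mono power_mono) (auto simp: a_def)
    finally show ?thesis using 1 by (simp add: L_def algebra_simps)
  qed
  have "m (Suc p) \<le> (D * B * L * K3) * (B * a / K4) ^ p * m p" for p
  proof -
    have "m (Suc p) \<le> D * B ^ Suc p * (L * a ^ p * M p)"
      using D by (intro order_trans[OF upper[of "Suc p"]] mult_left_mono shift) auto
    also have "\<dots> = D * B * L * (B * a / K4) ^ p * (K4 ^ p * M p)"
      using K by (simp add: power_mult_distrib power_divide)
    also have "\<dots> \<le> D * B * L * (B * a / K4) ^ p * (K3 * m p)"
      using lower[of p] D L a K by (intro mult_left_mono) auto
    finally show ?thesis by (simp add: mult_ac)
  qed
  moreover have "D * B * L * K3 \<ge> 0" "B * a / K4 \<ge> 0" using D L K a by auto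
  ultimately show "\<exists>K\<ge>0. \<exists>C\<ge>0. \<forall>p. m (Suc p) \<le> K * C ^ p * m p" by blast
qed
section \<open>Power series solutions of the moment differential system\<close>

lemma entire_power_series:
  assumes "\<And>z. (\<lambda>p. a p * z ^ p) sums f (z :: complex)"
  shows "f holomorphic_on UNIV" and "fps_nth (fps_expansion f 0) p = a p"
proof -
  have exp: "f has_fps_expansion Abs_fps a"
    using assms by (intro has_fps_expansionI) simp
  show "fps_nth (fps_expansion f 0) p = a p"
    using fps_nth_fps_expansion[OF exp, of p] by (simp add: fps_expansion_def)
  have "eval_fps (Abs_fps a) holomorphic_on eball 0 (fps_conv_radius (Abs_fps a))"
    by (intro holomorphic_on_eval_fps order_refl)
  moreover have "eval_fps (Abs_fps a) = f"
    using assms by (auto simp: eval_fps_def sums_iff)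
  moreover have "fps_conv_radius (Abs_fps a) = \<infinity>"
    unfolding fps_conv_radius_def
    using assms by (intro conv_radius_inftyI'') (auto simp: sums_iff)
  ultimately show "f holomorphic_on UNIV" by simp
qed

lemma entire_sums_expansion:
  assumes "f holomorphic_on UNIV"
  shows "(\<lambda>p. fps_nth (fps_expansion f 0) p * z ^ p) sums f z"
  using holomorphic_power_series[of f 0 "norm z + 1" z] assms holomorphic_on_subset
  by (fastforce simp: fps_expansion_def)

lemma matrix_power_entry_bound:
  fixes A :: "complex ^ 'n ^ 'n"
  shows "\<exists>B\<ge>0. \<forall>p i j. norm (matrix_power A p $ i $ j) \<le> B ^ p"
proof -
  obtain a where a: "\<And>i j. norm (A $ i $ j) \<le> a" 
  proof
    fix i j
    have "norm (A $ i $ j) \<le> norm (A $ i)" by (rule Finite_Cartesian_Product.norm_nth_le)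
    also have "\<dots> \<le> norm A" by (rule Finite_Cartesian_Product.norm_nth_le)
    finally show "norm (A $ i $ j) \<le> norm A" .
  qed
  have a0: "a \<ge> 0" using a norm_ge_zero order_trans by blast
  define B where "B = real CARD('n) * a"
  have "norm (matrix_power A p $ i $ j) \<le> B ^ p" for p i j
  proof (induction p arbitrary: i j)
    case 0
    then show ?case by (simp add: matrix_power_def mat_def)
  next
    case (Suc p)
    have "norm (matrix_power A (Suc p) $ i $ j) = norm (\<Sum>k\<in>UNIV. A $ i $ k * matrix_power A p $ k $ j)"
      by (simp add: matrix_power_def matrix_matrix_mult_def)
    also have "\<dots> \<le> (\<Sum>k\<in>(UNIV::'n set). a * B ^ p)"
      using Suc.IH a a0 by (intro sum_norm_le) (simp add: norm_mult mult_mono)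
    finally show ?case by (simp add: B_def mult_ac)
  qed
  moreover have "B \<ge> 0" using a0 by (simp add: B_def)
  ultimately show ?thesis by blast
qed

lemma matrix_power_Suc_vec: "matrix_power A (Suc p) *v v = A *v (matrix_power A p *v v)"
  by (simp add: matrix_power_def matrix_vector_mul_assoc)

text \<open>Entrywise the series is dominated by the scalar series \<open>\<Sum>p. x\<^sup>p / m(p)\<close> at \<open>x = B \<bar>z\<bar>\<close>, where
  \<open>B\<close> bounds the growth of the entries of the powers of \<open>A\<close>.\<close>

lemma gen_matrix_exp_sums:
  fixes A :: "complex ^ 'n ^ 'n"
  assumes pos: "\<And>p. m p > 0" and sm: "\<And>x. summable (\<lambda>p. x ^ p / m p)"
  shows "(\<lambda>p. (matrix_power A p *v v) $ i / complex_of_real (m p) * z ^ p)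
           sums ((gen_matrix_exp m A z *v v) $ i)"
proof -
  let ?T = "\<lambda>p. map_matrix (\<lambda>x. x / complex_of_real (m p) * z ^ p) (matrix_power A p)"
  obtain B where B: "B \<ge> 0" "\<And>p i j. norm (matrix_power A p $ i $ j) \<le> B ^ p"
    using matrix_power_entry_bound[of A] by auto
  have entry: "summable (\<lambda>p. ?T p $ i $ j)" for i j
  proof (rule summable_comparison_test')
    show "summable (\<lambda>p. (B * norm z) ^ p / m p)" by (rule sm)
    show "norm (?T p $ i $ j) \<le> (B * norm z) ^ p / m p" if "p \<ge> 0" for p
      using B(2)[of p i j] pos[of p]
      by (simp add: map_matrix_def norm_mult norm_divide norm_power power_mult_distrib
            divide_right_mono mult_right_mono)
  qed
  have "(\<lambda>n. \<Sum>p<n. ?T p) \<longlonglongrightarrow> (\<chi> i j. \<Sum>p. ?T p $ i $ j)"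
    using entry by (intro vec_tendstoI) (simp add: summable_LIMSEQ)
  then have "?T sums (\<chi> i j. \<Sum>p. ?T p $ i $ j)" by (simp add: sums_def)
  then have "gen_matrix_exp m A z = (\<chi> i j. \<Sum>p. ?T p $ i $ j)"
    unfolding gen_matrix_exp_def by (rule sums_unique[symmetric])
  then have "(\<lambda>p. ?T p $ i $ j) sums (gen_matrix_exp m A z $ i $ j)" for j
    using entry by (simp add: summable_sums)
  then have "(\<lambda>p. \<Sum>j\<in>UNIV. ?T p $ i $ j * v $ j) sums (\<Sum>j\<in>UNIV. gen_matrix_exp m A z $ i $ j * v $ j)"
    by (intro sums_sum sums_mult2)
  moreover have "(\<Sum>j\<in>UNIV. ?T p $ i $ j * v $ j) = (matrix_power A p *v v) $ i / complex_of_real (m p) * z ^ p" for p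
    by (simp add: map_matrix_def matrix_vector_mult_def sum_distrib_left sum_distrib_right sum_divide_distrib mult_ac)
  ultimately show ?thesis by (simp add: matrix_vector_mult_def)
qed

text \<open>The growth condition makes the differentiated series converge in the whole plane: the factor
  \<open>m (Suc p) / m p\<close> is absorbed by evaluating the entire series at a larger radius. This is
  needed since a divergent series has an unspecified value, for which the equation
  \<open>\<partial>\<^sub>m y = A y\<close> would not determine the coefficients.\<close>

lemma moment_deriv_sums:
  assumes pos: "\<And>p. m p > 0"
    and growth: "\<And>p. m (Suc p) \<le> K * C ^ p * m p" and KC: "K \<ge> 0" "C \<ge> 0"
    and f: "\<And>z. (\<lambda>p. a p / complex_of_real (m p) * z ^ p) sums f z"
  shows "(\<lambda>p. a (Suc p) / complex_of_real (m p) * z ^ p) sums moment_deriv m f z"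
proof -
  have nth: "fps_nth (fps_expansion f 0) p = a p / complex_of_real (m p)" for p
    using f by (rule entire_power_series)
  have "summable (\<lambda>p. a (Suc p) / complex_of_real (m p) * z ^ p)"
  proof (rule summable_norm_cancel, rule summable_comparison_test')
    let ?b = "\<lambda>p. a p / complex_of_real (m p)" and ?w = "C * norm z + 1"
    \<comment> \<open>The radius \<open>C \<bar>z\<bar> + 1\<close> is at least one, so that passing from the power \<open>p\<close> to \<open>Suc p\<close> only increases it.\<close>
    have w: "?w \<ge> 1" using KC by simp
    have "norm (complex_of_real ?w) < norm (complex_of_real (?w + 1))"
      using w by (simp only: norm_of_real)
    from powser_insidea[OF sums_summable[OF f] this]
    have "summable (\<lambda>p. norm (?b p) * norm (complex_of_real ?w) ^ p)"
      by (simp only: norm_mult norm_power)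
    also have "norm (complex_of_real ?w) = ?w"
      using w by (simp only: norm_of_real)
    finally show "summable (\<lambda>p. K * (norm (?b (Suc p)) * ?w ^ Suc p))"
      by (subst (asm) summable_Suc_iff[symmetric]) (rule summable_mult)
    fix p :: nat
    have "norm (a (Suc p) / complex_of_real (m p) * z ^ p)
        = norm (?b (Suc p)) * (m (Suc p) / m p) * norm z ^ p"
      using pos[of p] pos[of "Suc p"] by (simp add: norm_mult norm_divide norm_power)
    also have "\<dots> \<le> norm (?b (Suc p)) * (K * C ^ p) * norm z ^ p"
      using growth[of p] pos[of p] by (intro mult_right_mono mult_left_mono) (auto simp: field_simps)
    also have "\<dots> = K * (norm (?b (Suc p)) * (C * norm z) ^ p)"
      by (simp add: power_mult_distrib mult_ac)
    also have "(C * norm z) ^ p \<le> ?w ^ p"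
      using KC by (intro power_mono) auto
    also have "?w ^ p \<le> ?w ^ Suc p"
      using w by (intro power_increasing) auto
    finally show "norm (norm (a (Suc p) / complex_of_real (m p) * z ^ p)) \<le> K * (norm (?b (Suc p)) * ?w ^ Suc p)"
      using KC by (simp add: mult_left_mono)
  qed
  then show ?thesis
    using pos by (simp add: moment_deriv_def nth Let_def summable_sums less_imp_neq[symmetric])
qed

text \<open>If \<open>y = \<Sum>p. a\<^sub>p z\<^sup>p / m(p)\<close>, then \<open>\<partial>\<^sub>m\<close> shifts \<open>a\<close>, and uniqueness of Taylor coefficients makes the
  equation equivalent to \<open>a\<^sub>p\<^sub>+\<^sub>1 = A a\<^sub>p\<close>, that is \<open>a\<^sub>p = A\<^sup>p a\<^sub>0\<close>.\<close>

lemma moment_ode_solutions: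
  fixes m :: "nat \<Rightarrow> real" and A :: "complex ^ 'n ^ 'n"
  assumes pos: "\<And>p. m p > 0" and sm: "\<And>x. summable (\<lambda>p. x ^ p / m p)"
    and growth: "\<And>p. m (Suc p) \<le> K * C ^ p * m p" and KC: "K \<ge> 0" "C \<ge> 0"
  shows "(\<forall>i. (\<lambda>z. y z $ i) holomorphic_on UNIV) \<and> (\<forall>z. moment_deriv_vec m y z = A *v y z)
         \<longleftrightarrow> (\<exists>v. y = (\<lambda>z. gen_matrix_exp m A z *v v))"
proof (intro iffI; elim conjE exE)
  fix v assume y: "y = (\<lambda>z. gen_matrix_exp m A z *v v)"
  have sums: "(\<lambda>p. (matrix_power A p *v v) $ i / complex_of_real (m p) * z ^ p) sums (y z $ i)" for i z
    unfolding y by (rule gen_matrix_exp_sums[OF pos sm])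
  have "(\<lambda>z. y z $ i) holomorphic_on UNIV" for i
    using sums by (rule entire_power_series)
  moreover have "moment_deriv_vec m y z $ i = (A *v y z) $ i" for z i
  proof -
    have "(\<lambda>p. (matrix_power A (Suc p) *v v) $ i / complex_of_real (m p) * z ^ p)
        sums (moment_deriv_vec m y z $ i)"
      using moment_deriv_sums[OF pos growth KC, of "\<lambda>p. (matrix_power A p *v v) $ i"] sums
      by (simp add: moment_deriv_vec_def)
    moreover have "(\<lambda>p. (matrix_power A (Suc p) *v v) $ i / complex_of_real (m p) * z ^ p)
        sums ((A *v y z) $ i)"
    proof -
      have "(\<lambda>p. \<Sum>j\<in>UNIV. A $ i $ j * ((matrix_power A p *v v) $ j / complex_of_real (m p) * z ^ p))
              sums (\<Sum>j\<in>UNIV. A $ i $ j * (y z $ j))"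
        by (intro sums_sum sums_mult sums)
      moreover have "(\<Sum>j\<in>UNIV. A $ i $ j * ((matrix_power A p *v v) $ j / complex_of_real (m p) * z ^ p))
          = (matrix_power A (Suc p) *v v) $ i / complex_of_real (m p) * z ^ p" for p
        unfolding matrix_power_Suc_vec
        by (simp add: matrix_vector_mult_def[of A] sum_divide_distrib sum_distrib_right mult.assoc)
      ultimately show ?thesis by (simp add: matrix_vector_mult_def[of A])
    qed
    ultimately show ?thesis by (rule sums_unique2)
  qed
  ultimately show "(\<forall>i. (\<lambda>z. y z $ i) holomorphic_on UNIV) \<and> (\<forall>z. moment_deriv_vec m y z = A *v y z)"
    by (simp add: vec_eq_iff)
next
  assume hol: "\<forall>i. (\<lambda>z. y z $ i) holomorphic_on UNIV"
    and ode: "\<forall>z. moment_deriv_vec m y z = A *v y z"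
  define a where "a p = (\<chi> i. complex_of_real (m p) * fps_nth (fps_expansion (\<lambda>z. y z $ i) 0) p)" for p
  have m0: "m p \<noteq> 0" for p using pos[of p] by simp
  have sums: "(\<lambda>p. a p $ i / complex_of_real (m p) * z ^ p) sums (y z $ i)" for i z
    using entire_sums_expansion[OF hol[rule_format, of i], of z] by (simp add: a_def m0)
  have rec: "a (Suc p) = A *v a p" for p
  proof -
    have "a (Suc p) $ i / complex_of_real (m p) = (A *v a p) $ i / complex_of_real (m p)" for i
    proof -
      have l: "(\<lambda>p. a (Suc p) $ i / complex_of_real (m p) * z ^ p) sums ((A *v y z) $ i)" for z
        using moment_deriv_sums[OF pos growth KC sums, of i z] ode[rule_format, of z]
        by (simp add: moment_deriv_vec_def vec_eq_iff)
      have r: "(\<lambda>p. (A *v a p) $ i / complex_of_real (m p) * z ^ p) sums ((A *v y z) $ i)" for z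
      proof -
        have "(\<lambda>p. \<Sum>j\<in>UNIV. A $ i $ j * (a p $ j / complex_of_real (m p) * z ^ p))
              sums (\<Sum>j\<in>UNIV. A $ i $ j * (y z $ j))"
          by (intro sums_sum sums_mult sums)
        then show ?thesis
          by (simp add: matrix_vector_mult_def sum_divide_distrib sum_distrib_right mult.assoc)
      qed
      show ?thesis
        by (rule trans[OF entire_power_series(2)[OF l, symmetric] entire_power_series(2)[OF r]])
    qed
    then show ?thesis by (simp add: vec_eq_iff m0)
  qed
  have sol: "a p = matrix_power A p *v a 0" for p
  proof (induction p)
    case 0
    then show ?case by (simp add: matrix_power_def)
  qed (simp add: rec matrix_power_Suc_vec)
  have "y z $ i = (gen_matrix_exp m A z *v a 0) $ i" for z i
  proof (rule sums_unique2)
    show "(\<lambda>p. (matrix_power A p *v a 0) $ i / complex_of_real (m p) * z ^ p) sums (y z $ i)"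
      using sums[of i z] by (simp only: sol[symmetric])
  qed (rule gen_matrix_exp_sums[OF pos sm])
  then have "y = (\<lambda>z. gen_matrix_exp m A z *v a 0)" by (simp add: fun_eq_iff vec_eq_iff)
  then show "\<exists>v. y = (\<lambda>z. gen_matrix_exp m A z *v v)" by blast
qed

theorem theorem3p5:
  fixes m :: "nat \<Rightarrow> real" and A :: "complex ^ 'n ^ 'n"
  assumes "kernel_moment_sequence m"
    and "\<not> diagonalizable A"
  shows "{y. (\<forall>i. (\<lambda>z. y z $ i) holomorphic_on UNIV) \<and>
             (\<forall>z. moment_deriv_vec m y z = A *v y z)}
         = {y. \<exists>v :: complex ^ 'n. y = (\<lambda>z. gen_matrix_exp m A z *v v)}"
proof -
  obtain K C where KC: "K \<ge> 0" "C \<ge> 0" and growth: "\<And>p. m (Suc p) \<le> K * C ^ p * m p"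
    using kernel_moment_sequence_properties(3)[OF assms(1)] by blast
  note m = kernel_moment_sequence_properties(1,2)[OF assms(1)]
  show ?thesis
    by (rule Collect_cong) (rule moment_ode_solutions[of m K C, OF m growth KC])
qed

end
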